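(* The closure $\mathrm{CFT}$ of $F(\mathrm{GT})$, where $\mathrm{GT}=\Pi^+\cup(\Pi^0\setminus\{A,B,C\})$, is a subset of $$\mathbb{P}=\left\{(x,y,z)\in[-1,1]^3\mid 1+2xyz-x^2-y^2-z^2\ge 0\right\}$$ and has the following form: $$\mathrm{CFT}=F\bigl(\Pi^+\cup(\Pi^0\setminus\{A,B,C\})\bigr)\cup\{(1,1,1)\}\cup\mathrm{Lim}(A)\cup\mathrm{Lim}(B)\cup\mathrm{Lim}(C).$$
   Context: Let $\Pi^0=\{(p,q,0)\}\subset\mathbb{R}^3$ and $\Pi^+=\{(p,q,r)\in\mathbb{R}^3\mid r>0\}$; $ABC$ is a non-degenerate triangle in $\Pi^0$. The map $F:\mathrm{GT}\to\mathbb{R}^3$ is $F(D)=(\cos\angle BDC,\cos\angle ADC,\cos\angle ADB)$. With $x_0=\cos\angle BAC$, $y_0=\cos\angle ABC$, $z_0=\cos\angle ACB$, $\mathrm{Lim}(A)=\{(x_0,y,z)\mid y^2+z^2-2x_0yz\le 1-x_0^2\}$, $\mathrm{Lim}(B)=\{(x,y_0,z)\mid x^2+z^2-2y_0xz\le 1-y_0^2\}$, $\mathrm{Lim}(C)=\{(x,y,z_0)\mid x^2+y^2-2z_0xy\le 1-z_0^2\}$. *)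

theory Defs
  imports "HOL-Analysis.Analysis"
begin

(* The angle X Y Z with vertex Y, in [0, pi]; meaningful only for X \<noteq> Y and Z \<noteq> Y
   (by the convention x / 0 = 0 it is pi / 2 otherwise). *)
definition angle :: "real^3 \<Rightarrow> real^3 \<Rightarrow> real^3 \<Rightarrow> real" where
  "angle X Y Z = arccos (((X - Y) \<bullet> (Z - Y)) / (norm (X - Y) * norm (Z - Y)))"

definition Pi_zero :: "(real^3) set" where
  "Pi_zero = {vector [p, q, 0] | p q. True}"

definition Pi_plus :: "(real^3) set" where
  "Pi_plus = {vector [p, q, r] | p q r. r > 0}"

definition GT :: "real^3 \<Rightarrow> real^3 \<Rightarrow> real^3 \<Rightarrow> (real^3) set" where
  "GT A B C = Pi_plus \<union> (Pi_zero - {A, B, C})"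

(* Only the values at points D of GT A B C matter, where D differs from A, B and C. *)
definition F :: "real^3 \<Rightarrow> real^3 \<Rightarrow> real^3 \<Rightarrow> real^3 \<Rightarrow> real^3" where
  "F A B C D = vector [cos (angle B D C), cos (angle A D C), cos (angle A D B)]"

definition CFT :: "real^3 \<Rightarrow> real^3 \<Rightarrow> real^3 \<Rightarrow> (real^3) set" where
  "CFT A B C = closure (F A B C ` GT A B C)"

definition PP :: "(real^3) set" where
  "PP = {vector [x, y, z] | x y z.
     x \<in> {-1..1} \<and> y \<in> {-1..1} \<and> z \<in> {-1..1} \<and>
     1 + 2 * x * y * z - x\<^sup>2 - y\<^sup>2 - z\<^sup>2 \<ge> 0}"

definition Lim_A :: "real^3 \<Rightarrow> real^3 \<Rightarrow> real^3 \<Rightarrow> (real^3) set" where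
  "Lim_A A B C = (let x0 = cos (angle B A C) in
     {vector [x0, y, z] | y z. y\<^sup>2 + z\<^sup>2 - 2 * x0 * y * z \<le> 1 - x0\<^sup>2})"

definition Lim_B :: "real^3 \<Rightarrow> real^3 \<Rightarrow> real^3 \<Rightarrow> (real^3) set" where
  "Lim_B A B C = (let y0 = cos (angle A B C) in
     {vector [x, y0, z] | x z. x\<^sup>2 + z\<^sup>2 - 2 * y0 * x * z \<le> 1 - y0\<^sup>2})"

definition Lim_C :: "real^3 \<Rightarrow> real^3 \<Rightarrow> real^3 \<Rightarrow> (real^3) set" where
  "Lim_C A B C = (let z0 = cos (angle A C B) in
     {vector [x, y, z0] | x y. x\<^sup>2 + y\<^sup>2 - 2 * z0 * x * y \<le> 1 - z0\<^sup>2})"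

end

theory Submission
  imports Defs
begin

text \<open>
  Writing \<open>a\<close>, \<open>b\<close>, \<open>c\<close> for the unit vectors pointing from \<open>D\<close> to \<open>A\<close>, \<open>B\<close>, \<open>C\<close>, the three
  coordinates of \<open>F(D)\<close> are the inner products \<open>b \<bullet> c\<close>, \<open>a \<bullet> c\<close>, \<open>a \<bullet> b\<close>, and the inequality defining
  \<open>PP\<close> says that their Gram determinant is nonnegative. A limit point of \<open>F(GT)\<close> comes from a
  sequence of points \<open>D\<close> that, after passing to a subsequence, either converges in \<open>GT\<close>, where \<open>F\<close> is
  continuous, or tends to infinity in a fixed direction, when \<open>a\<close>, \<open>b\<close>, \<open>c\<close> get a common limit and
  \<open>F(D)\<close> tends to \<open>(1,1,1)\<close>, or tends to a vertex, say \<open>A\<close>, with \<open>a\<close> converging to a unit vector \<open>v\<close>.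
  The Gram inequality for \<open>v\<close> and the directions of the two sides at \<open>A\<close> is the one in \<open>Lim_A\<close>.
  Conversely, a point of \<open>Lim_A\<close> prescribes the inner products of \<open>v\<close> with these two directions, which
  determines the horizontal part of \<open>v\<close>; the inequality says that this part lies in the unit disc,
  so it lifts to a unit vector pointing downwards, and \<open>D\<close> can approach \<open>A\<close> along it.
\<close>

section \<open>Cosines of angles as inner products of unit vectors, and coordinates of space\<close>

lemma cos_angle: "cos (angle X Y Z) = sgn (X - Y) \<bullet> sgn (Z - Y)"
proof -
  \<comment> \<open>This also covers \<open>X = Y\<close> and \<open>Z = Y\<close>: division by zero
    and \<open>sgn 0\<close> both make the two sides 0.\<close>
  have eq: "((X - Y) \<bullet> (Z - Y)) / (norm (X - Y) * norm (Z - Y)) = sgn (X - Y) \<bullet> sgn (Z - Y)"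
    by (simp add: sgn_div_norm divide_simps)
  have "\<bar>sgn (X - Y) \<bullet> sgn (Z - Y)\<bar> \<le> norm (sgn (X - Y)) * norm (sgn (Z - Y))"
    by (rule Cauchy_Schwarz_ineq2)
  also have "\<dots> \<le> 1"
    by (simp add: norm_sgn)
  finally have "\<bar>sgn (X - Y) \<bullet> sgn (Z - Y)\<bar> \<le> 1" .
  then show ?thesis
    unfolding angle_def eq by (simp add: abs_le_iff)
qed

lemma F_eq_sgn:
  "F A B C D = vector [sgn (B - D) \<bullet> sgn (C - D), sgn (A - D) \<bullet> sgn (C - D), sgn (A - D) \<bullet> sgn (B - D)]"
  by (simp add: F_def cos_angle)

lemma vector3_components: "vector [p $ 1, p $ 2, p $ 3] = (p :: real^3)"
  by (simp add: vec_eq_iff forall_3)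

lemma Pi_plus_eq: "Pi_plus = {D. D $ 3 > 0}"
  unfolding Pi_plus_def using vector3_components by (fastforce intro: sym)

lemma Pi_zero_eq: "Pi_zero = {D. D $ 3 = 0}"
proof (intro set_eqI iffI)
  fix D :: "real^3" assume "D \<in> {D. D $ 3 = 0}"
  then have "D = vector [D $ 1, D $ 2, 0]"
    using vector3_components[of D] by simp
  then show "D \<in> Pi_zero"
    unfolding Pi_zero_def by blast
qed (auto simp: Pi_zero_def)

lemma tendsto_vector3:
  fixes f g h :: "'a \<Rightarrow> real"
  assumes "(f \<longlongrightarrow> a) net" "(g \<longlongrightarrow> b) net" "(h \<longlongrightarrow> c) net"
  shows "((\<lambda>n. vector [f n, g n, h n] :: real^3) \<longlongrightarrow> vector [a, b, c]) net"
proof (rule vec_tendstoI)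
  fix i :: 3
  show "((\<lambda>n. (vector [f n, g n, h n] :: real^3) $ i) \<longlongrightarrow> vector [a, b, c] $ i) net"
    using assms exhaust_3[of i] by auto
qed

section \<open>The Gram inequality and the set \<open>PP\<close>\<close>

text \<open>This is Cauchy-Schwarz for the components of \<open>a\<close> and \<open>b\<close>
  orthogonal to \<open>c\<close>; the products of the squares of \<open>a \<bullet> c\<close> and
  \<open>b \<bullet> c\<close> cancel. The vector \<open>a\<close> is singled out to match the shape
  of the \<open>Lim\<close> sets, where it becomes the limit direction.\<close>

lemma gram_ineq:
  fixes a b c :: "'a::real_inner"
  assumes "norm a = 1" "norm b = 1" "norm c = 1"
  shows "(a \<bullet> c)\<^sup>2 + (a \<bullet> b)\<^sup>2 - 2 * (b \<bullet> c) * (a \<bullet> c) * (a \<bullet> b) \<le> 1 - (b \<bullet> c)\<^sup>2"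
proof -
  have 1: "a \<bullet> a = 1" "b \<bullet> b = 1" "c \<bullet> c = 1"
    using assms by (simp_all add: norm_eq_1)
  define a' b' where "a' = a - (a \<bullet> c) *\<^sub>R c" and "b' = b - (b \<bullet> c) *\<^sub>R c"
  have "(a' \<bullet> b')\<^sup>2 \<le> (a' \<bullet> a') * (b' \<bullet> b')"
    by (rule Cauchy_Schwarz_ineq)
  moreover have "a' \<bullet> b' = a \<bullet> b - (a \<bullet> c) * (b \<bullet> c)"
    "a' \<bullet> a' = 1 - (a \<bullet> c)\<^sup>2" "b' \<bullet> b' = 1 - (b \<bullet> c)\<^sup>2"
    by (simp_all add: a'_def b'_def inner_diff inner_commute 1 power2_eq_square)
  ultimately show ?thesis
    by (simp add: power2_eq_square algebra_simps)
qed

lemma PP_iff: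
  "p \<in> PP \<longleftrightarrow> \<bar>p $ 1\<bar> \<le> 1 \<and> \<bar>p $ 2\<bar> \<le> 1 \<and> \<bar>p $ 3\<bar> \<le> 1 \<and>
    1 + 2 * p $ 1 * p $ 2 * p $ 3 - (p $ 1)\<^sup>2 - (p $ 2)\<^sup>2 - (p $ 3)\<^sup>2 \<ge> 0"
  (is "_ \<longleftrightarrow> ?R")
proof
  show "p \<in> PP \<Longrightarrow> ?R"
    by (auto simp: PP_def abs_le_iff)
  assume ?R
  then show "p \<in> PP"
    unfolding PP_def mem_Collect_eq
    by (intro exI[of _ "p $ 1"] exI[of _ "p $ 2"] exI[of _ "p $ 3"])
      (simp add: vector3_components abs_le_iff minus_le_iff)
qed

lemma closed_PP: "closed PP"
proof -
  have "PP = {p. \<bar>p $ 1\<bar> \<le> 1} \<inter> {p. \<bar>p $ 2\<bar> \<le> 1} \<inter> {p. \<bar>p $ 3\<bar> \<le> 1} \<inter>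
    {p. 0 \<le> 1 + 2 * p $ 1 * p $ 2 * p $ 3 - (p $ 1)\<^sup>2 - (p $ 2)\<^sup>2 - (p $ 3)\<^sup>2}"
    using PP_iff by blast
  also have "closed \<dots>"
    by (intro closed_Int closed_Collect_le continuous_intros)
  finally show ?thesis .
qed

lemma F_in_PP:
  assumes "D \<noteq> A" "D \<noteq> B" "D \<noteq> C"
  shows "F A B C D \<in> PP"
proof -
  have n: "norm (sgn (A - D)) = 1" "norm (sgn (B - D)) = 1" "norm (sgn (C - D)) = 1"
    using assms by (simp_all add: norm_sgn)
  show ?thesis
    unfolding PP_iff F_eq_sgn
    using gram_ineq[OF n] Cauchy_Schwarz_ineq2[of "sgn (A - D)" "sgn (B - D)"]
      Cauchy_Schwarz_ineq2[of "sgn (A - D)" "sgn (C - D)"]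
      Cauchy_Schwarz_ineq2[of "sgn (B - D)" "sgn (C - D)"]
    by (simp add: n algebra_simps)
qed

section \<open>Limits of directions, at infinity and at a point\<close>

lemma unit_vectors_convergent_subseq:
  fixes f :: "nat \<Rightarrow> 'a::euclidean_space"
  assumes "\<And>n. norm (f n) = 1"
  obtains v r where "norm v = 1" "strict_mono r" "(f \<circ> r) \<longlonglongrightarrow> v"
  using compact_imp_seq_compact[OF compact_sphere[of "0::'a" 1]] assms
  unfolding seq_compact_def by (metis mem_sphere_0)

lemma sgn_scaleR_pos: "t > 0 \<Longrightarrow> sgn (t *\<^sub>R x) = sgn (x::'a::real_normed_vector)"
  by (simp add: sgn_scaleR)

text \<open>Dividing \<open>X - D n\<close> by \<open>norm (D n)\<close> does not change its
  direction and makes the contribution of \<open>X\<close> vanish in the limit. What remains tends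
  to \<open>- e\<close>, which is nonzero, so \<open>sgn\<close> is continuous there.\<close>

lemma tendsto_sgn_at_infinity:
  fixes D :: "nat \<Rightarrow> 'a::real_normed_vector"
  assumes inf: "filterlim (\<lambda>n. norm (D n)) at_top sequentially"
    and dir: "(\<lambda>n. sgn (D n)) \<longlonglongrightarrow> e" and e: "norm e = 1"
  shows "(\<lambda>n. sgn (X - D n)) \<longlonglongrightarrow> - e"
proof -
  have "(\<lambda>n. inverse (norm (D n))) \<longlonglongrightarrow> 0"
    using tendsto_inverse_0_at_top[OF inf] .
  then have "(\<lambda>n. inverse (norm (D n)) *\<^sub>R X - sgn (D n)) \<longlonglongrightarrow> 0 *\<^sub>R X - e"
    by (intro tendsto_intros dir)
  then have "(\<lambda>n. sgn (inverse (norm (D n)) *\<^sub>R X - sgn (D n))) \<longlonglongrightarrow> sgn (0 *\<^sub>R X - e)"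
    by (rule tendsto_sgn) (use e in auto)
  moreover have "sgn (0 *\<^sub>R X - e) = - e"
    using e by (simp add: sgn_div_norm)
  moreover have "\<forall>\<^sub>F n in sequentially. sgn (inverse (norm (D n)) *\<^sub>R X - sgn (D n)) = sgn (X - D n)"
    using filterlim_at_top_dense[THEN iffD1, OF inf, rule_format, of 0]
  proof eventually_elim
    case (elim n)
    have "inverse (norm (D n)) *\<^sub>R X - sgn (D n) = inverse (norm (D n)) *\<^sub>R (X - D n)"
      by (simp add: sgn_div_norm scaleR_diff_right divide_inverse)
    then show ?case
      using elim by (simp add: sgn_scaleR_pos)
  qed
  ultimately show ?thesis
    by (simp add: tendsto_cong)
qed

lemma tendsto_F_at_infinity:
  assumes "filterlim (\<lambda>n. norm (D n)) at_top sequentially"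
    and "(\<lambda>n. sgn (D n)) \<longlonglongrightarrow> e" and "norm e = 1"
  shows "(\<lambda>n. F A B C (D n)) \<longlonglongrightarrow> vector [1, 1, 1]"
proof -
  have "(\<lambda>n. sgn (X - D n) \<bullet> sgn (Y - D n)) \<longlonglongrightarrow> (- e) \<bullet> (- e)" for X Y
    by (intro tendsto_inner tendsto_sgn_at_infinity assms)
  moreover have "(- e) \<bullet> (- e) = 1"
    using assms(3) by (simp add: norm_eq_1)
  ultimately show ?thesis
    unfolding F_eq_sgn by (intro tendsto_vector3) simp_all
qed

lemma tendsto_sgn_diff:
  fixes D :: "'b \<Rightarrow> 'a::real_normed_vector"
  assumes "(D \<longlongrightarrow> P) net" "X \<noteq> P"
  shows "((\<lambda>n. sgn (X - D n)) \<longlongrightarrow> sgn (X - P)) net"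
  using assms by (intro tendsto_intros) auto

section \<open>Unit vectors with prescribed inner products, and approach to a vertex\<close>

lemma not_collinear_imp_distinct:
  assumes "\<not> collinear {A, B, C}"
  shows "A \<noteq> B" "A \<noteq> C" "B \<noteq> C"
  using assms by (auto simp: insert_commute)

lemma unit_vector_with_inner_products:
  fixes P Q R :: "real^3"
  assumes planar: "P \<in> Pi_zero" "Q \<in> Pi_zero" "R \<in> Pi_zero"
    and ncol: "\<not> collinear {P, Q, R}"
    and x0: "x0 = sgn (Q - P) \<bullet> sgn (R - P)"
    and le: "y\<^sup>2 + z\<^sup>2 - 2 * x0 * y * z \<le> 1 - x0\<^sup>2"
  obtains v where "norm v = 1" "v $ 3 \<le> 0" "v \<bullet> sgn (R - P) = y" "v \<bullet> sgn (Q - P) = z"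
proof -
  define b c where "b = sgn (Q - P)" and "c = sgn (R - P)"
  have ne: "Q \<noteq> P" "R \<noteq> P"
    using not_collinear_imp_distinct[OF ncol] by auto
  have 1: "b \<bullet> b = 1" "c \<bullet> c = 1"
    using ne by (simp_all add: b_def c_def norm_sgn flip: norm_eq_1)
  have 3: "b $ 3 = 0" "c $ 3 = 0"
    using planar by (simp_all add: b_def c_def sgn_div_norm Pi_zero_eq)
  have x0': "b \<bullet> c = x0" "c \<bullet> b = x0"
    by (simp_all add: x0 b_def c_def inner_commute)
  \<comment> \<open>Absolute value 1 would be equality in Cauchy-Schwarz for the two sides at
    \<open>P\<close>, making them parallel.\<close>
  have "\<bar>x0\<bar> \<noteq> 1"
  proof
    assume "\<bar>x0\<bar> = 1"
    then have "\<bar>(Q - P) \<bullet> (R - P)\<bar> = norm (Q - P) * norm (R - P)"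
      using ne unfolding x0 by (simp add: sgn_div_norm abs_mult divide_simps)
    then have "collinear {0, Q - P, R - P}"
      by (simp add: norm_cauchy_schwarz_equal)
    then have "collinear {Q, P, R}"
      by (subst collinear_3) auto
    then show False
      using ncol by (simp add: insert_commute)
  qed
  moreover have "\<bar>x0\<bar> \<le> 1"
    using Cauchy_Schwarz_ineq2[of b c] 1 x0' by (simp add: norm_eq_sqrt_inner)
  ultimately have "x0\<^sup>2 < 1"
    by (simp add: abs_square_less_1)
  \<comment> \<open>\<open>d\<close> is the determinant of the Gram matrix of \<open>b\<close> and
    \<open>c\<close>; it is positive because these are independent.\<close>
  define d where "d = 1 - x0\<^sup>2"
  have d: "d > 0" "x0 * x0 = 1 - d"
    using \<open>x0\<^sup>2 < 1\<close> by (simp_all add: d_def power2_eq_square)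
  \<comment> \<open>The coefficients solve the 2x2 linear system \<open>w \<bullet> b = z\<close>,
    \<open>w \<bullet> c = y\<close> by inverting that Gram matrix.\<close>
  define w where "w = ((z - x0 * y) / d) *\<^sub>R b + ((y - x0 * z) / d) *\<^sub>R c"
  have wb: "w \<bullet> b = z" and wc: "w \<bullet> c = y" and w3: "w $ 3 = 0"
    using d 3 by (simp_all add: w_def inner_add_left 1 x0' field_simps)
      (simp_all add: algebra_simps d(2) flip: mult.assoc)
  have "w \<bullet> w = ((z - x0 * y) / d) * (w \<bullet> b) + ((y - x0 * z) / d) * (w \<bullet> c)"
    \<comment> \<open>Only the second factor is expanded, so that the known products
      \<open>w \<bullet> b\<close> and \<open>w \<bullet> c\<close> appear.\<close>
    by (subst (2) w_def) (simp add: inner_add_right)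
  also have "\<dots> = (y\<^sup>2 + z\<^sup>2 - 2 * x0 * y * z) / d"
    using d by (simp add: wb wc field_simps power2_eq_square)
  also have "\<dots> \<le> 1"
    using le d(1) by (simp add: d_def)
  finally have ww: "w \<bullet> w \<le> 1" .
  \<comment> \<open>The vertical term brings the length to 1 and is orthogonal to \<open>b\<close>
    and \<open>c\<close>. It points down so that \<open>P - t *\<^sub>R v\<close> with
    \<open>t > 0\<close> has nonnegative height.\<close>
  define v where "v = w - sqrt (1 - w \<bullet> w) *\<^sub>R axis 3 1"
  have orth: "u \<bullet> axis 3 1 = u $ 3" "axis 3 1 \<bullet> u = u $ 3" "(axis 3 1 :: real^3) $ 3 = 1"
    for u :: "real^3"
    by (simp_all add: inner_axis inner_axis' axis_nth)
  have "v \<bullet> v = 1"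
    using ww w3 by (simp add: v_def inner_diff orth)
  moreover have "v \<bullet> b = z" "v \<bullet> c = y"
    by (simp_all add: v_def inner_diff_left orth 3 wb wc)
  moreover have "v $ 3 \<le> 0"
    using ww by (simp add: v_def w3 orth)
  ultimately show ?thesis
    using that by (simp add: b_def c_def norm_eq_1)
qed

lemma GT_eq:
  assumes "A \<in> Pi_zero" "B \<in> Pi_zero" "C \<in> Pi_zero"
  shows "GT A B C = {D. D $ 3 \<ge> 0} - {A, B, C}"
  using assms by (auto simp: GT_def Pi_plus_eq Pi_zero_eq)

lemma approach_along_direction:
  fixes P v :: "real^3"
  assumes "P \<in> Pi_zero" "norm v = 1" "v $ 3 \<le> 0" "P \<noteq> Q" "P \<noteq> R"
  obtains D where "D \<longlonglongrightarrow> P" "\<And>n. sgn (P - D n) = v"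
    "\<forall>\<^sub>F n in sequentially. D n \<in> {D. D $ 3 \<ge> 0} - {P, Q, R}"
proof -
  \<comment> \<open>The direction from \<open>D n\<close> to \<open>P\<close> is exactly
    \<open>v\<close> for every \<open>n\<close>; \<open>Suc\<close> keeps the step length positive
    and finite at \<open>n = 0\<close>. The points may meet \<open>Q\<close> or \<open>R\<close> at
    first, but not eventually.\<close>
  define D where "D n = P - inverse (real (Suc n)) *\<^sub>R v" for n
  have "D \<longlonglongrightarrow> P - 0 *\<^sub>R v"
    unfolding D_def by (intro tendsto_intros LIMSEQ_inverse_real_of_nat)
  then have lim: "D \<longlonglongrightarrow> P"
    by simp
  have sgn: "sgn (P - D n) = v" for n
    using assms(2) by (simp add: D_def sgn_scaleR_pos sgn_div_norm del: of_nat_Suc)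
  have "D n \<noteq> P" for n
    using sgn[of n] assms(2) by auto
  moreover have "D n $ 3 \<ge> 0" for n
    using assms(1,3) by (simp add: D_def Pi_zero_eq mult_nonneg_nonpos)
  moreover have "\<forall>\<^sub>F n in sequentially. D n \<noteq> Q" "\<forall>\<^sub>F n in sequentially. D n \<noteq> R"
    using lim assms(4,5) by (blast intro: tendsto_imp_eventually_ne)+
  ultimately have "\<forall>\<^sub>F n in sequentially. D n \<in> {D. D $ 3 \<ge> 0} - {P, Q, R}"
    by (simp add: eventually_conj_iff)
  with lim sgn show ?thesis
    by (rule that)
qed

section \<open>Classification of the limit points\<close>

lemma CFT_subset:
  assumes planar: "A \<in> Pi_zero" "B \<in> Pi_zero" "C \<in> Pi_zero"
    and ne: "A \<noteq> B" "A \<noteq> C" "B \<noteq> C"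
    and p: "p \<in> CFT A B C"
  shows "p \<in> F A B C ` GT A B C \<union> {vector [1, 1, 1]} \<union> Lim_A A B C \<union> Lim_B A B C \<union> Lim_C A B C"
proof -
  obtain f where f: "\<And>n. f n \<in> F A B C ` GT A B C" "f \<longlonglongrightarrow> p"
    using p unfolding CFT_def closure_sequential by blast
  then obtain D where D: "\<And>n. D n \<in> GT A B C" "\<And>n. f n = F A B C (D n)"
    unfolding image_iff by metis
  then have Dlim: "(\<lambda>n. F A B C (D n)) \<longlonglongrightarrow> p"
    using f(2) by (simp flip: D(2))
  show ?thesis
  proof (cases "bounded (range D)")
    case True
    then obtain E r where r: "strict_mono r" "(D \<circ> r) \<longlonglongrightarrow> E"
      using bounded_imp_convergent_subsequence by blast
    define G where "G = D \<circ> r"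
    have G: "G \<longlonglongrightarrow> E" "\<And>n. G n \<in> GT A B C" "(\<lambda>n. F A B C (G n)) \<longlonglongrightarrow> p"
      using r D(1) LIMSEQ_subseq_LIMSEQ[OF Dlim r(1)] by (simp_all add: G_def o_def)
    have Gne: "G n \<noteq> A" "G n \<noteq> B" "G n \<noteq> C" for n
      using G(2)[of n] by (auto simp: GT_eq[OF planar])
    have "G n $ 3 \<ge> 0" for n
      using G(2)[of n] by (auto simp: GT_eq[OF planar])
    \<comment> \<open>The closed half-space keeps the limit \<open>E\<close>, so \<open>E\<close>
      can leave \<open>GT A B C\<close> only by being a vertex.\<close>
    then have E3: "E $ 3 \<ge> 0"
      using tendsto_vec_nth[OF G(1), of 3] by (intro LIMSEQ_le_const) auto
    \<comment> \<open>The direction to a vertex need not converge along \<open>G\<close>.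
      Compactness of the unit sphere gives a further subsequence where it does, and the other two
      limits survive.\<close>
    have dir: "\<exists>v s. norm v = 1 \<and> strict_mono s \<and> (\<lambda>n. sgn (P - G (s n))) \<longlonglongrightarrow> v
        \<and> (\<lambda>n. G (s n)) \<longlonglongrightarrow> E \<and> (\<lambda>n. F A B C (G (s n))) \<longlonglongrightarrow> p"
      if "\<And>n. G n \<noteq> P" for P
    proof -
      have "norm (sgn (P - G n)) = 1" for n
        using that[of n] by (auto simp: norm_sgn)
      then obtain v s where v: "norm v = 1" "strict_mono s" "((\<lambda>n. sgn (P - G n)) \<circ> s) \<longlonglongrightarrow> v"
        by (rule unit_vectors_convergent_subseq)
      show ?thesis
        using v LIMSEQ_subseq_LIMSEQ[OF G(1) v(2)] LIMSEQ_subseq_LIMSEQ[OF G(3) v(2)]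
        unfolding o_def by blast
    qed
    have gram: "(v \<bullet> sgn (Y - P))\<^sup>2 + (v \<bullet> sgn (X - P))\<^sup>2
        - 2 * (sgn (X - P) \<bullet> sgn (Y - P)) * (v \<bullet> sgn (Y - P)) * (v \<bullet> sgn (X - P))
        \<le> 1 - (sgn (X - P) \<bullet> sgn (Y - P))\<^sup>2"
      if "norm v = 1" "P \<noteq> X" "P \<noteq> Y" for v X Y P :: "real^3"
      using that by (intro gram_ineq) (auto simp: norm_sgn)
    consider "E = A" | "E = B" | "E = C" | "E \<notin> {A, B, C}"
      by blast
    then show ?thesis
    proof cases
      case 1
      obtain v s where v: "norm v = 1" and s: "(\<lambda>n. sgn (A - G (s n))) \<longlonglongrightarrow> v"
        "(\<lambda>n. G (s n)) \<longlonglongrightarrow> A" "(\<lambda>n. F A B C (G (s n))) \<longlonglongrightarrow> p"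
        using dir[OF Gne(1)] 1 by blast
      have "(\<lambda>n. F A B C (G (s n))) \<longlonglongrightarrow> vector [sgn (B - A) \<bullet> sgn (C - A), v \<bullet> sgn (C - A), v \<bullet> sgn (B - A)]"
        unfolding F_eq_sgn using ne s by (intro tendsto_vector3 tendsto_inner tendsto_sgn_diff) auto
      then have "p = vector [sgn (B - A) \<bullet> sgn (C - A), v \<bullet> sgn (C - A), v \<bullet> sgn (B - A)]"
        by (rule LIMSEQ_unique[OF s(3)])
      moreover have "\<dots> \<in> Lim_A A B C"
        unfolding Lim_A_def Let_def cos_angle
        using gram[OF v ne(1,2)] by - (intro CollectI exI conjI, rule refl)
      ultimately show ?thesis by simp
    next
      case 2
      obtain v s where v: "norm v = 1" and s: "(\<lambda>n. sgn (B - G (s n))) \<longlonglongrightarrow> v"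
        "(\<lambda>n. G (s n)) \<longlonglongrightarrow> B" "(\<lambda>n. F A B C (G (s n))) \<longlonglongrightarrow> p"
        using dir[OF Gne(2)] 2 by blast
      have lim: "(\<lambda>n. F A B C (G (s n))) \<longlonglongrightarrow> vector [v \<bullet> sgn (C - B), sgn (A - B) \<bullet> sgn (C - B), sgn (A - B) \<bullet> v]"
        unfolding F_eq_sgn using ne s by (intro tendsto_vector3 tendsto_inner tendsto_sgn_diff) auto
      then have "p = vector [v \<bullet> sgn (C - B), sgn (A - B) \<bullet> sgn (C - B), v \<bullet> sgn (A - B)]"
        using LIMSEQ_unique[OF s(3) lim] by (simp add: inner_commute)
      moreover have "\<dots> \<in> Lim_B A B C"
        unfolding Lim_B_def Let_def cos_angle
        using gram[OF v ne(1)[symmetric] ne(3)] by - (intro CollectI exI conjI, rule refl)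
      ultimately show ?thesis by simp
    next
      case 3
      obtain v s where v: "norm v = 1" and s: "(\<lambda>n. sgn (C - G (s n))) \<longlonglongrightarrow> v"
        "(\<lambda>n. G (s n)) \<longlonglongrightarrow> C" "(\<lambda>n. F A B C (G (s n))) \<longlonglongrightarrow> p"
        using dir[OF Gne(3)] 3 by blast
      have lim: "(\<lambda>n. F A B C (G (s n))) \<longlonglongrightarrow> vector [sgn (B - C) \<bullet> v, sgn (A - C) \<bullet> v, sgn (A - C) \<bullet> sgn (B - C)]"
        unfolding F_eq_sgn using ne s by (intro tendsto_vector3 tendsto_inner tendsto_sgn_diff) auto
      then have "p = vector [v \<bullet> sgn (B - C), v \<bullet> sgn (A - C), sgn (A - C) \<bullet> sgn (B - C)]"
        using LIMSEQ_unique[OF s(3) lim] by (simp add: inner_commute)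
      moreover have "\<dots> \<in> Lim_C A B C"
        unfolding Lim_C_def Let_def cos_angle
        using gram[OF v ne(2,3)[symmetric]] by - (intro CollectI exI conjI, rule refl)
      ultimately show ?thesis by simp
    next
      case 4
      have "(\<lambda>n. F A B C (G n)) \<longlonglongrightarrow> F A B C E"
        unfolding F_eq_sgn using 4 G(1) by (intro tendsto_vector3 tendsto_inner tendsto_sgn_diff) auto
      then have "p = F A B C E"
        by (rule LIMSEQ_unique[OF G(3)])
      moreover have "E \<in> GT A B C"
        using 4 E3 by (simp add: GT_eq[OF planar])
      ultimately show ?thesis by blast
    qed
  next
    case False
    obtain r where r: "strict_mono r" "\<And>n. norm (D (r n)) > real n"
    proof -
      \<comment> \<open>Otherwise all terms after index \<open>m\<close> lie in a ball; the finitely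
        many others cannot make the range unbounded.\<close>
      have large: "\<exists>n>m. norm (D n) > K" for m K
      proof (rule ccontr)
        assume "\<not> ?thesis"
        then have "range D \<subseteq> D ` {..m} \<union> cball 0 K"
          by (auto simp: not_less)
        then show False
          using False by (metis bounded_Un bounded_cball bounded_subset finite_atMost finite_imageI finite_imp_bounded)
      qed
      then have "\<exists>r. \<forall>n. norm (D (r n)) > real n \<and> r (Suc n) > r n"
        by (rule_tac dependent_nat_choice) (use large in blast)+
      then show ?thesis
        using that by (metis strict_mono_Suc_iff)
    qed
    have nz: "D (r n) \<noteq> 0" for n
      using r(2)[of n] by auto
    \<comment> \<open>A second extraction makes the direction of the escaping points converge as
      well.\<close>
    obtain e s where e: "norm e = 1" and s: "strict_mono s" "((\<lambda>n. sgn (D (r n))) \<circ> s) \<longlonglongrightarrow> e"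
      by (rule unit_vectors_convergent_subseq[of "\<lambda>n. sgn (D (r n))"]) (auto simp: norm_sgn nz)
    have "filterlim (\<lambda>n. norm (D (r n))) at_top sequentially"
      by (rule filterlim_at_top_mono[OF filterlim_real_sequentially])
        (use r(2) in \<open>simp add: less_imp_le\<close>)
    then have "filterlim (\<lambda>n. norm (D (r (s n)))) at_top sequentially"
      by (rule filterlim_compose) (rule filterlim_subseq[OF s(1)])
    then have "(\<lambda>n. F A B C (D (r (s n)))) \<longlonglongrightarrow> vector [1, 1, 1]"
      by (rule tendsto_F_at_infinity) (use s e in \<open>auto simp: o_def\<close>)
    moreover have "(\<lambda>n. F A B C (D (r (s n)))) \<longlonglongrightarrow> p"
      using LIMSEQ_subseq_LIMSEQ[OF Dlim strict_mono_o[OF r(1) s(1)]] by (simp add: o_def)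
    ultimately have "p = vector [1, 1, 1]"
      using LIMSEQ_unique by blast
    then show ?thesis
      by simp
  qed
qed

section \<open>Realization of all claimed limit points\<close>

lemma tendsto_in_CFT:
  assumes "(\<lambda>n. F A B C (D n)) \<longlonglongrightarrow> p" "\<forall>\<^sub>F n in sequentially. D n \<in> GT A B C"
  shows "p \<in> CFT A B C"
  unfolding CFT_def
proof (rule Lim_in_closed_set[OF closed_closure _ _ assms(1)])
  show "\<forall>\<^sub>F n in sequentially. F A B C (D n) \<in> closure (F A B C ` GT A B C)"
    using assms(2) by eventually_elim (intro subsetD[OF closure_subset] imageI)
qed simp

lemma one_in_CFT: "vector [1, 1, 1] \<in> CFT A B C"
proof (rule tendsto_in_CFT)
  let ?e = "axis 3 1 :: real^3"
  \<comment> \<open>Climbing the vertical axis stays in \<open>Pi_plus\<close> and has constant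
    direction; \<open>Suc\<close> avoids the origin.\<close>
  let ?D = "\<lambda>n. real (Suc n) *\<^sub>R ?e"
  have e: "norm ?e = 1"
    by (simp add: norm_axis_1)
  have "norm (?D n) = real (Suc n)" for n
    by (simp add: e)
  then have "filterlim (\<lambda>n. norm (?D n)) at_top sequentially"
    using filterlim_compose[OF filterlim_real_sequentially filterlim_Suc] by simp
  moreover have "(\<lambda>n. sgn (?D n)) \<longlonglongrightarrow> ?e"
    by (simp add: sgn_scaleR_pos sgn_div_norm e del: of_nat_Suc)
  ultimately show "(\<lambda>n. F A B C (?D n)) \<longlonglongrightarrow> vector [1, 1, 1]"
    using e by (rule tendsto_F_at_infinity)
  have "?D n \<in> GT A B C" for n
    by (simp add: GT_def Pi_plus_eq axis_def)
  then show "\<forall>\<^sub>F n in sequentially. ?D n \<in> GT A B C"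
    by (intro always_eventually allI)
qed

text \<open>Stating the limits for separate inner products rather than for \<open>F\<close> lets one
  argument serve every vertex: \<open>F\<close> fixes the order of its coordinates, while
  \<open>P\<close>, \<open>Q\<close>, \<open>R\<close> can be permuted freely.\<close>

lemma approach_vertex:
  fixes P Q R :: "real^3"
  assumes planar: "P \<in> Pi_zero" "Q \<in> Pi_zero" "R \<in> Pi_zero"
    and ncol: "\<not> collinear {P, Q, R}"
    and le: "y\<^sup>2 + z\<^sup>2 - 2 * (sgn (Q - P) \<bullet> sgn (R - P)) * y * z \<le> 1 - (sgn (Q - P) \<bullet> sgn (R - P))\<^sup>2"
  obtains D where "\<forall>\<^sub>F n in sequentially. D n \<in> GT P Q R"
    "(\<lambda>n. sgn (Q - D n) \<bullet> sgn (R - D n)) \<longlonglongrightarrow> sgn (Q - P) \<bullet> sgn (R - P)"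
    "(\<lambda>n. sgn (P - D n) \<bullet> sgn (R - D n)) \<longlonglongrightarrow> y"
    "(\<lambda>n. sgn (P - D n) \<bullet> sgn (Q - D n)) \<longlonglongrightarrow> z"
proof -
  note ne = not_collinear_imp_distinct(1,2)[OF ncol]
  obtain v where v: "norm v = 1" "v $ 3 \<le> 0" "v \<bullet> sgn (R - P) = y" "v \<bullet> sgn (Q - P) = z"
    using unit_vector_with_inner_products[OF planar ncol refl le] by blast
  obtain D where D: "D \<longlonglongrightarrow> P" "\<And>n. sgn (P - D n) = v"
    "\<forall>\<^sub>F n in sequentially. D n \<in> {D. D $ 3 \<ge> 0} - {P, Q, R}"
    using approach_along_direction[OF planar(1) v(1,2) ne] by blast
  show ?thesis
  proof
    show "\<forall>\<^sub>F n in sequentially. D n \<in> GT P Q R"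
      using D(3) by (simp add: GT_eq[OF planar])
    show "(\<lambda>n. sgn (Q - D n) \<bullet> sgn (R - D n)) \<longlonglongrightarrow> sgn (Q - P) \<bullet> sgn (R - P)"
      using D(1) ne by (intro tendsto_inner tendsto_sgn_diff) auto
    show "(\<lambda>n. sgn (P - D n) \<bullet> sgn (R - D n)) \<longlonglongrightarrow> y"
      \<comment> \<open>The first factor is constantly \<open>v\<close>; only the second one varies
        with \<open>n\<close>.\<close>
      unfolding D(2) v(3)[symmetric] using D(1) ne by (intro tendsto_intros tendsto_sgn_diff) auto
    show "(\<lambda>n. sgn (P - D n) \<bullet> sgn (Q - D n)) \<longlonglongrightarrow> z"
      unfolding D(2) v(4)[symmetric] using D(1) ne by (intro tendsto_intros tendsto_sgn_diff) auto
  qed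
qed

lemma Lim_subset_CFT:
  assumes planar: "A \<in> Pi_zero" "B \<in> Pi_zero" "C \<in> Pi_zero"
    and ncol: "\<not> collinear {A, B, C}"
  shows "Lim_A A B C \<union> Lim_B A B C \<union> Lim_C A B C \<subseteq> CFT A B C"
proof (intro Un_least subsetI)
  fix p assume "p \<in> Lim_A A B C"
  then obtain y z where p: "p = vector [sgn (B - A) \<bullet> sgn (C - A), y, z]"
    and le: "y\<^sup>2 + z\<^sup>2 - 2 * (sgn (B - A) \<bullet> sgn (C - A)) * y * z \<le> 1 - (sgn (B - A) \<bullet> sgn (C - A))\<^sup>2"
    unfolding Lim_A_def Let_def cos_angle by blast
  obtain D where D: "\<forall>\<^sub>F n in sequentially. D n \<in> GT A B C"
    "(\<lambda>n. sgn (B - D n) \<bullet> sgn (C - D n)) \<longlonglongrightarrow> sgn (B - A) \<bullet> sgn (C - A)"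
    "(\<lambda>n. sgn (A - D n) \<bullet> sgn (C - D n)) \<longlonglongrightarrow> y"
    "(\<lambda>n. sgn (A - D n) \<bullet> sgn (B - D n)) \<longlonglongrightarrow> z"
    using approach_vertex[OF planar ncol le] by blast
  have "(\<lambda>n. F A B C (D n)) \<longlonglongrightarrow> p"
    unfolding p F_eq_sgn using D by (intro tendsto_vector3)
  then show "p \<in> CFT A B C"
    using D(1) by (rule tendsto_in_CFT)
next
  fix p assume "p \<in> Lim_B A B C"
  then obtain x z where p: "p = vector [x, sgn (A - B) \<bullet> sgn (C - B), z]"
    and le: "x\<^sup>2 + z\<^sup>2 - 2 * (sgn (A - B) \<bullet> sgn (C - B)) * x * z \<le> 1 - (sgn (A - B) \<bullet> sgn (C - B))\<^sup>2"
    unfolding Lim_B_def Let_def cos_angle by blast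
  \<comment> \<open>Here \<open>B\<close> takes the role of \<open>P\<close>. Neither collinearity
    nor \<open>GT\<close> depends on the order of the vertices.\<close>
  have perm: "\<not> collinear {B, A, C}" "GT B A C = GT A B C"
    using ncol by (simp_all add: GT_def insert_commute)
  obtain D where D: "\<forall>\<^sub>F n in sequentially. D n \<in> GT B A C"
    "(\<lambda>n. sgn (A - D n) \<bullet> sgn (C - D n)) \<longlonglongrightarrow> sgn (A - B) \<bullet> sgn (C - B)"
    "(\<lambda>n. sgn (B - D n) \<bullet> sgn (C - D n)) \<longlonglongrightarrow> x"
    "(\<lambda>n. sgn (B - D n) \<bullet> sgn (A - D n)) \<longlonglongrightarrow> z"
    using approach_vertex[OF planar(2,1,3) perm(1) le] by blast
  have "(\<lambda>n. F A B C (D n)) \<longlonglongrightarrow> p"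
    unfolding p F_eq_sgn using D by (intro tendsto_vector3) (simp_all add: inner_commute)
  then show "p \<in> CFT A B C"
    using D(1)[unfolded perm(2)] by (rule tendsto_in_CFT)
next
  fix p assume "p \<in> Lim_C A B C"
  then obtain x y where p: "p = vector [x, y, sgn (A - C) \<bullet> sgn (B - C)]"
    and le: "x\<^sup>2 + y\<^sup>2 - 2 * (sgn (A - C) \<bullet> sgn (B - C)) * x * y \<le> 1 - (sgn (A - C) \<bullet> sgn (B - C))\<^sup>2"
    unfolding Lim_C_def Let_def cos_angle by blast
  \<comment> \<open>In the order \<open>C\<close>, \<open>A\<close>, \<open>B\<close>, the
    prescribed values for \<open>B\<close> and \<open>A\<close> are \<open>x\<close> and
    \<open>y\<close>, as the coordinates of \<open>F\<close> require.\<close>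
  have perm: "\<not> collinear {C, A, B}" "GT C A B = GT A B C"
    using ncol by (simp_all add: GT_def insert_commute)
  obtain D where D: "\<forall>\<^sub>F n in sequentially. D n \<in> GT C A B"
    "(\<lambda>n. sgn (A - D n) \<bullet> sgn (B - D n)) \<longlonglongrightarrow> sgn (A - C) \<bullet> sgn (B - C)"
    "(\<lambda>n. sgn (C - D n) \<bullet> sgn (B - D n)) \<longlonglongrightarrow> x"
    "(\<lambda>n. sgn (C - D n) \<bullet> sgn (A - D n)) \<longlonglongrightarrow> y"
    using approach_vertex[OF planar(3,1,2) perm(1) le] by blast
  have "(\<lambda>n. F A B C (D n)) \<longlonglongrightarrow> p"
    unfolding p F_eq_sgn using D by (intro tendsto_vector3) (simp_all add: inner_commute)
  then show "p \<in> CFT A B C"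
    using D(1)[unfolded perm(2)] by (rule tendsto_in_CFT)
qed

theorem proposition12:
  fixes A B C :: "real^3"
  assumes "A \<in> Pi_zero" and "B \<in> Pi_zero" and "C \<in> Pi_zero"
    and "\<not> collinear {A, B, C}"
  shows "CFT A B C \<subseteq> PP \<and>
    CFT A B C = F A B C ` (Pi_plus \<union> (Pi_zero - {A, B, C})) \<union> {vector [1, 1, 1]}
      \<union> Lim_A A B C \<union> Lim_B A B C \<union> Lim_C A B C"
proof
  \<comment> \<open>Since \<open>PP\<close> is closed, it suffices to place the image itself inside
    it.\<close>
  have "F A B C ` GT A B C \<subseteq> PP"
    using F_in_PP by (auto simp: GT_eq[OF assms(1-3)])
  then show "CFT A B C \<subseteq> PP"
    unfolding CFT_def by (rule closure_minimal) (rule closed_PP)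
  show "CFT A B C = F A B C ` (Pi_plus \<union> (Pi_zero - {A, B, C})) \<union> {vector [1, 1, 1]}
      \<union> Lim_A A B C \<union> Lim_B A B C \<union> Lim_C A B C" (is "_ = ?R")
  proof (rule equalityI)
    show "CFT A B C \<subseteq> ?R"
      using CFT_subset[OF assms(1-3) not_collinear_imp_distinct[OF assms(4)]]
      unfolding GT_def by (rule subsetI)
    have "F A B C ` (Pi_plus \<union> (Pi_zero - {A, B, C})) \<subseteq> CFT A B C"
      unfolding CFT_def GT_def by (rule closure_subset)
    then show "?R \<subseteq> CFT A B C"
      using Lim_subset_CFT[OF assms] one_in_CFT by (simp only: Un_subset_iff) simp
  qed
qed

end
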